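(* Let $\eta\in\Omega$, and suppose that $0<\left|\{x\in\mathbb Z_{\ge0}\ ;\ \xi_k(x)=i\}\right|<\infty$ for some $k\in\mathbb N$ and $i\in\mathbb Z_{\ge0}$. Then $0<\left|\{x\in\mathbb Z_{\ge0}\ ;\ T\xi_k(x)=i\}\right|<\infty$ and $$(T\zeta)_k(i)=\zeta_k(i-k),$$ with the convention that $\zeta_k(i)=0$ for any $i<0$.
   Context: $\mathbb N=\{1,2,\dots\}$ and $\Omega=\{0,1\}^{\mathbb N}$ (ball configurations). Box-ball dynamics: for $\eta\in\Omega$ let $W_\infty:\mathbb Z_{\ge0}\to\mathbb Z_{\ge 0}$ be given by $W_\infty(0)=0$, $W_\infty(x)=W_\infty(x-1)+\eta(x)-\min\{1-\eta(x),W_\infty(x-1)\}$, and let $T:\Omega\to\Omega$ be $T\eta(x)=\eta(x)+W_\infty(x-1)-W_\infty(x)$. For any quantity $f$ depending on $\eta$, $Tf$ denotes the same quantity computed from $T\eta$, i.e. $Tf(\eta)=f(T\eta)$. Carrier with seat numbers: for $\eta\in\Omega$ define $\mathcal W_k:\mathbb Z_{\ge0}\to\{0,1\}$, $k\in\mathbb N$, by $\mathcal W_k(0)=0$ and $$\mathcal W_k(x)=\mathcal W_k(x-1)+\eta(x)(1-\mathcal W_k(x-1))\prod_{\ell=1}^{k-1}\mathcal W_\ell(x-1)-(1-\eta(x))\mathcal W_k(x-1)\prod_{\ell=1}^{k-1}(1-\mathcal W_\ell(x-1)).$$ Seat number configuration: for $k,x\in\mathbb N$, $\eta^\uparrow_k(x)=\mathbf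 1_{\{\mathcal W_k(x)>\mathcal W_k(x-1)\}}$ and $\eta^\downarrow_k(x)=\mathbf 1_{\{\mathcal W_k(x)<\mathcal W_k(x-1)\}}$. For $k\in\mathbb N$, $x\in\mathbb Z_{\ge0}$, $\sigma\in\{\uparrow,\downarrow\}$ (empty sums are $0$): $$m^\sigma_k(x)=\sum_{y=1}^x\left(\eta^\sigma_k(y)-\eta^\sigma_{k+1}(y)\right),\qquad \xi_k(x)=x-\sum_{\ell=1}^k\sum_{y=1}^x\left(\eta^\uparrow_\ell(y)+\eta^\downarrow_\ell(y)\right).$$ For $k,j\in\mathbb N$, $\tau_k(j)=\min\{x\in\mathbb Z_{\ge0}\ ;\ m^\sigma_k(x)\ge j\text{ for both }\sigma\in\{\uparrow,\downarrow\}\}$, with $\min\emptyset=\infty$. For $k\in\mathbb N$, $i\in\mathbb Z_{\ge0}$, $$\zeta_k(i)=\left|\left\{j\in\mathbb N\ ;\ \tau_k(j)\in\{x\in\mathbb Z_{\ge0}\ ;\ \xi_k(x)=i\}\right\}\right|.$$ *)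

theory Defs
  imports Main "HOL-Library.FuncSet" "HOL-Library.Extended_Nat"
begin

text \<open>
  Ball configurations are functions on \<^typ>\<open>nat\<close> constrained only on the sites 1, 2, ...;
  the value at 0 is unconstrained and is never used below. The codomain is
  \<^typ>\<open>int\<close>, so that no subtraction is truncated.
\<close>

definition Omega :: "(nat \<Rightarrow> int) set" where
  "Omega = {1..} \<rightarrow> {0, 1}"

primrec W_inf :: "(nat \<Rightarrow> int) \<Rightarrow> nat \<Rightarrow> int" where
  "W_inf \<eta> 0 = 0"
| "W_inf \<eta> (Suc x) = W_inf \<eta> x + \<eta> (Suc x) - min (1 - \<eta> (Suc x)) (W_inf \<eta> x)"

definition T :: "(nat \<Rightarrow> int) \<Rightarrow> nat \<Rightarrow> int" where
  "T \<eta> x = \<eta> x + W_inf \<eta> (x - 1) - W_inf \<eta> x"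

text \<open>\<open>seat \<eta> k x\<close> is $\mathcal W_k(x)$, for $k \ge 1$.\<close>

primrec seat :: "(nat \<Rightarrow> int) \<Rightarrow> nat \<Rightarrow> nat \<Rightarrow> int" where
  "seat \<eta> k 0 = 0"
| "seat \<eta> k (Suc x) = seat \<eta> k x
     + \<eta> (Suc x) * (1 - seat \<eta> k x) * (\<Prod>l = 1..<k. seat \<eta> l x)
     - (1 - \<eta> (Suc x)) * seat \<eta> k x * (\<Prod>l = 1..<k. 1 - seat \<eta> l x)"

datatype arrow = Up | Down

fun seat_config :: "arrow \<Rightarrow> (nat \<Rightarrow> int) \<Rightarrow> nat \<Rightarrow> nat \<Rightarrow> int" where
  "seat_config Up \<eta> k x = of_bool (seat \<eta> k x > seat \<eta> k (x - 1))"
| "seat_config Down \<eta> k x = of_bool (seat \<eta> k x < seat \<eta> k (x - 1))"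

definition m :: "arrow \<Rightarrow> (nat \<Rightarrow> int) \<Rightarrow> nat \<Rightarrow> nat \<Rightarrow> int" where
  "m \<sigma> \<eta> k x = (\<Sum>y = 1..x. seat_config \<sigma> \<eta> k y - seat_config \<sigma> \<eta> (k + 1) y)"

definition xi :: "(nat \<Rightarrow> int) \<Rightarrow> nat \<Rightarrow> nat \<Rightarrow> int" where
  "xi \<eta> k x = int x - (\<Sum>l = 1..k. \<Sum>y = 1..x. seat_config Up \<eta> l y + seat_config Down \<eta> l y)"

text \<open>In \<^typ>\<open>enat\<close> the infimum of a nonempty set is its minimum, and that of \<open>{}\<close> is \<open>\<infinity>\<close>.\<close>

definition tau :: "(nat \<Rightarrow> int) \<Rightarrow> nat \<Rightarrow> nat \<Rightarrow> enat" where
  "tau \<eta> k j = Inf (enat ` {x. \<forall>\<sigma>. m \<sigma> \<eta> k x \<ge> int j})"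

text \<open>Unlike \<^const>\<open>card\<close>, this does not send infinite sets to 0.\<close>

definition ecard :: "'a set \<Rightarrow> enat" where
  "ecard A = (if finite A then enat (card A) else \<infinity>)"

definition xi_level :: "(nat \<Rightarrow> int) \<Rightarrow> nat \<Rightarrow> int \<Rightarrow> nat set" where
  "xi_level \<eta> k i = {x. xi \<eta> k x = i}"

text \<open>The index is an integer in order to include the convention $\zeta_k(i) = 0$ for $i < 0$.\<close>

definition zeta :: "(nat \<Rightarrow> int) \<Rightarrow> nat \<Rightarrow> int \<Rightarrow> enat" where
  "zeta \<eta> k i = (if i < 0 then 0 else ecard {j. j \<ge> 1 \<and> tau \<eta> k j \<in> enat ` xi_level \<eta> k i})"

end

theory Submission
  imports Defs
begin

text \<open>
  Run the carrier of \<open>\<eta>\<close> (occupied seats \<open>U\<close>) and the carrier of \<open>T \<eta>\<close> (occupied seats \<open>V\<close>)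
  side by side. Up to the largest element of \<open>U\<close>, the set \<open>V\<close> is always the complement of \<open>U\<close>.
  Hence \<open>T \<eta>\<close> loads seat \<open>l\<close> exactly when \<open>\<eta>\<close> unloads it, and \<open>\<xi>\<^sub>k\<close> grows under \<open>T\<close> by the
  number of elements of \<open>U\<close> and \<open>V\<close> up to \<open>k\<close>, which is at most \<open>k\<close> and equals \<open>k\<close> at the time
  \<open>\<tau>\<^sub>k(j)\<close>. The minimum of the two counters \<open>m\<^sub>k\<close> for \<open>T \<eta>\<close> equals that for \<open>\<eta>\<close> minus
  a delay of 0 or 1, and while the delay is 1 the function \<open>\<xi>\<^sub>k\<close> of \<open>T \<eta>\<close> does not
  move. So \<open>T\<close> raises the value of \<open>\<xi>\<^sub>k\<close> at \<open>\<tau>\<^sub>k(j)\<close> by exactly \<open>k\<close>, unless the delay never ends,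
  which is impossible if the level is finite.
\<close>

section \<open>Carrier dynamics in terms of occupied seats\<close>

definition occ :: "(nat \<Rightarrow> int) \<Rightarrow> nat \<Rightarrow> nat \<Rightarrow> bool" where
  "occ \<eta> l x \<longleftrightarrow> seat \<eta> l x = 1"

text \<open>The time \<open>x\<close> in \<open>loads\<close> and \<open>unloads\<close> refers to the step from \<open>x\<close> to site \<open>Suc x\<close>.\<close>

definition loads :: "(nat \<Rightarrow> int) \<Rightarrow> nat \<Rightarrow> nat \<Rightarrow> bool" where
  "loads \<eta> l x \<longleftrightarrow> \<not> occ \<eta> l x \<and> occ \<eta> l (Suc x)"

definition unloads :: "(nat \<Rightarrow> int) \<Rightarrow> nat \<Rightarrow> nat \<Rightarrow> bool" where
  "unloads \<eta> l x \<longleftrightarrow> occ \<eta> l x \<and> \<not> occ \<eta> l (Suc x)"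

lemma Omega_cases:
  assumes "\<eta> \<in> Omega"
  shows "\<eta> (Suc x) = 0 \<or> \<eta> (Suc x) = 1"
  using assms by (auto simp: Omega_def Pi_def)

lemma prod_of_bool_int: "finite A \<Longrightarrow> (\<Prod>l\<in>A. of_bool (P l) :: int) = of_bool (\<forall>l\<in>A. P l)"
  by (induction A rule: finite_induct) auto

text \<open>That seats are 0-1 valued is assumed at the single time \<open>x\<close>, for all seats.
  The lemma can then be both the induction step of \<open>seat_of_bool\<close> and the source of
  \<open>occ_Suc\<close>.\<close>

lemma seat_Suc_of_bool:
  assumes "\<eta> \<in> Omega" "\<And>l. seat \<eta> l x = of_bool (occ \<eta> l x)"
  shows "seat \<eta> l (Suc x) = of_bool (if \<eta> (Suc x) = 1
    then occ \<eta> l x \<or> (\<forall>j\<in>{1..<l}. occ \<eta> j x)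
    else occ \<eta> l x \<and> (\<exists>j\<in>{1..<l}. occ \<eta> j x))"
proof -
  have "1 - seat \<eta> j x = of_bool (\<not> occ \<eta> j x)" for j
    by (simp add: assms(2))
  then show ?thesis
    using Omega_cases[OF assms(1), of x]
    by (simp only: seat.simps assms(2) prod_of_bool_int finite_atLeastLessThan) auto
qed

lemma seat_of_bool:
  assumes "\<eta> \<in> Omega"
  shows "seat \<eta> l x = of_bool (occ \<eta> l x)"
proof (induction x arbitrary: l)
  case (Suc x)
  then show ?case
    unfolding occ_def[of _ _ "Suc x"] seat_Suc_of_bool[OF assms Suc.IH] by simp
qed (simp add: occ_def)

lemma occ_0 [simp]: "\<not> occ \<eta> l 0"
  by (simp add: occ_def)

lemma occ_Suc:
  assumes "\<eta> \<in> Omega"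
  shows "occ \<eta> l (Suc x) \<longleftrightarrow>
    (if \<eta> (Suc x) = 1 then occ \<eta> l x \<or> (\<forall>j\<in>{1..<l}. occ \<eta> j x)
     else occ \<eta> l x \<and> (\<exists>j\<in>{1..<l}. occ \<eta> j x))"
  unfolding occ_def[of _ _ "Suc x"] seat_Suc_of_bool[OF assms seat_of_bool[OF assms]] by simp

lemma loads_iff:
  assumes "\<eta> \<in> Omega"
  shows "loads \<eta> l x \<longleftrightarrow> \<eta> (Suc x) = 1 \<and> \<not> occ \<eta> l x \<and> (\<forall>j\<in>{1..<l}. occ \<eta> j x)"
  unfolding loads_def occ_Suc[OF assms] by auto

lemma unloads_iff:
  assumes "\<eta> \<in> Omega"
  shows "unloads \<eta> l x \<longleftrightarrow> \<eta> (Suc x) \<noteq> 1 \<and> occ \<eta> l x \<and> (\<forall>j\<in>{1..<l}. \<not> occ \<eta> j x)"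
  unfolding unloads_def occ_Suc[OF assms] by auto

text \<open>A seat is filled only when all lower ones are full, so after \<open>x\<close> sites the
  vacant seat \<open>Suc x\<close> blocks every higher seat. This makes the carrier's content finite
  and guarantees a vacant seat for the next ball.\<close>

lemma occ_le:
  assumes "\<eta> \<in> Omega" "occ \<eta> l x"
  shows "l \<le> x"
  using assms(2)
proof (induction x arbitrary: l)
  case (Suc x)
  show ?case
  proof (cases "occ \<eta> l x")
    case True
    then show ?thesis using Suc.IH by fastforce
  next
    case False
    then have all: "\<forall>j\<in>{1..<l}. occ \<eta> j x"
      using Suc.prems by (auto simp: occ_Suc[OF assms(1)] split: if_splits)
    show ?thesis
    proof (rule ccontr)
      assume "\<not> l \<le> Suc x"
      then have "occ \<eta> (Suc x) x" using all by auto
      then show False using Suc.IH by fastforce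
    qed
  qed
qed simp

section \<open>Lowest occupied and vacant seats, and the load of the carrier\<close>

lemma ex_least_occ:
  assumes "occ \<eta> l x" "l \<ge> 1"
  obtains p where "p \<ge> 1" "p \<le> l" "occ \<eta> p x" "\<forall>j\<in>{1..<p}. \<not> occ \<eta> j x"
proof -
  define p where "p = (LEAST p. p \<ge> 1 \<and> occ \<eta> p x)"
  have 1: "p \<ge> 1 \<and> occ \<eta> p x"
    unfolding p_def by (rule LeastI[of _ l]) (use assms in simp)
  have 2: "p \<le> l"
    unfolding p_def by (rule Least_le) (use assms in simp)
  have 3: "\<forall>j\<in>{1..<p}. \<not> occ \<eta> j x"
    unfolding p_def by (auto dest: not_less_Least)
  from 1 2 3 show thesis by (intro that) auto
qed

lemma ex_least_vacant:
  assumes "\<not> occ \<eta> l x" "l \<ge> 1"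
  obtains p where "p \<ge> 1" "p \<le> l" "\<not> occ \<eta> p x" "\<forall>j\<in>{1..<p}. occ \<eta> j x"
proof -
  define p where "p = (LEAST p. p \<ge> 1 \<and> \<not> occ \<eta> p x)"
  have 1: "p \<ge> 1 \<and> \<not> occ \<eta> p x"
    unfolding p_def by (rule LeastI[of _ l]) (use assms in simp)
  have 2: "p \<le> l"
    unfolding p_def by (rule Least_le) (use assms in simp)
  have 3: "\<forall>j\<in>{1..<p}. occ \<eta> j x"
    unfolding p_def by (auto dest: not_less_Least)
  from 1 2 3 show thesis by (intro that) auto
qed

text \<open>A ball always takes the lowest vacant seat, and an empty site always frees the lowest
  occupied one if there is any. Exactly one seat changes in each such case, which is the recursion
  of \<open>W_inf\<close>.\<close>

lemma W_inf_eq_card: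
  assumes "\<eta> \<in> Omega"
  shows "W_inf \<eta> x = int (card {l. l \<ge> 1 \<and> occ \<eta> l x})"
proof (induction x)
  case (Suc x)
  let ?S = "\<lambda>x. {l. l \<ge> 1 \<and> occ \<eta> l x}"
  have fin: "finite (?S x)"
    by (rule finite_subset[of _ "{..x}"]) (auto dest: occ_le[OF assms])
  show ?case
  proof (cases "\<eta> (Suc x) = 1")
    case True
    have "\<not> occ \<eta> (Suc x) x" using occ_le[OF assms, of "Suc x" x] by auto
    then obtain p where p: "p \<ge> 1" "\<not> occ \<eta> p x" "\<forall>j\<in>{1..<p}. occ \<eta> j x"
      by (rule ex_least_vacant) auto
    have "loads \<eta> l x \<longleftrightarrow> l = p" if "l \<ge> 1" for l
      using that p True unfolding loads_iff[OF assms]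
      by (metis atLeastLessThan_iff linorder_neqE_nat)
    moreover have "occ \<eta> l (Suc x) \<longleftrightarrow> occ \<eta> l x \<or> loads \<eta> l x" for l
      using True by (auto simp: loads_def occ_Suc[OF assms])
    ultimately have "?S (Suc x) = insert p (?S x)"
      using p(1) by blast
    then show ?thesis
      using Suc.IH fin p True by simp
  next
    case False
    then have 0: "\<eta> (Suc x) = 0" using Omega_cases[OF assms] by auto
    show ?thesis
    proof (cases "?S x = {}")
      case True
      then have "?S (Suc x) = {}" using 0 by (auto simp: occ_Suc[OF assms])
      moreover have "W_inf \<eta> x = 0" using Suc.IH unfolding True by simp
      ultimately show ?thesis by (simp only: W_inf.simps 0 card.empty)
    next
      case ne: False
      then obtain p where p: "p \<ge> 1" "occ \<eta> p x" "\<forall>j\<in>{1..<p}. \<not> occ \<eta> j x"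
        by (auto elim: ex_least_occ)
      have "unloads \<eta> l x \<longleftrightarrow> l = p" if "l \<ge> 1" for l
        using that p False unfolding unloads_iff[OF assms]
        by (metis atLeastLessThan_iff linorder_neqE_nat)
      moreover have "occ \<eta> l (Suc x) \<longleftrightarrow> occ \<eta> l x \<and> \<not> unloads \<eta> l x" for l
        using False by (auto simp: unloads_def occ_Suc[OF assms])
      ultimately have "?S (Suc x) = ?S x - {p}"
        by blast
      moreover have "card (?S x) > 0" using ne fin by (simp add: card_gt_0_iff)
      ultimately show ?thesis using Suc.IH p 0 fin by (simp add: of_nat_diff)
    qed
  qed
qed simp

lemma T_Suc:
  assumes "\<eta> \<in> Omega"
  shows "T \<eta> (Suc x) = of_bool (\<eta> (Suc x) \<noteq> 1 \<and> (\<exists>l\<ge>1. occ \<eta> l x))"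
proof -
  let ?S = "{l. l \<ge> 1 \<and> occ \<eta> l x}"
  have "finite ?S"
    by (rule finite_subset[of _ "{..x}"]) (auto dest: occ_le[OF assms])
  then have "card ?S = 0 \<longleftrightarrow> \<not> (\<exists>l\<ge>1. occ \<eta> l x)"
    by auto
  then have "min 1 (int (card ?S)) = of_bool (\<exists>l\<ge>1. occ \<eta> l x)"
    by (cases "card ?S") auto
  then show ?thesis
    using Omega_cases[OF assms, of x] W_inf_eq_card[OF assms, of x]
    by (auto simp: T_def)
qed

section \<open>The carriers of a configuration and of its image, side by side\<close>

lemma T_Omega:
  assumes "\<eta> \<in> Omega"
  shows "T \<eta> \<in> Omega"
proof -
  have "T \<eta> x \<in> {0, 1}" if "x \<ge> 1" for x
    using T_Suc[OF assms, of "x - 1"] that by (auto simp del: of_bool_conj)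
  then show ?thesis by (simp add: Omega_def)
qed

text \<open>Induction on \<open>x\<close> for all \<open>j\<close> and \<open>l\<close> at once.
  Where the occupied seats are complementary up to \<open>l\<close>, the lowest vacant seat of one
  carrier is the lowest occupied seat of the other, so opposite moves preserve the
  complement.\<close>

lemma occ_T:
  assumes "\<eta> \<in> Omega" "1 \<le> j" "j \<le> l" "occ \<eta> l x"
  shows "occ (T \<eta>) j x \<longleftrightarrow> \<not> occ \<eta> j x"
  using assms(2-)
proof (induction x arbitrary: j l)
  case (Suc x)
  note s = occ_Suc[OF assms(1)] and s' = occ_Suc[OF T_Omega[OF assms(1)]] and t = T_Suc[OF assms(1)]
  show ?case
  proof (cases "\<eta> (Suc x) = 1")
    case True
    then have t0: "T \<eta> (Suc x) = 0" by (simp add: t)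
    show ?thesis
    proof (cases "occ \<eta> l x")
      case occl: True
      have "\<And>i. 1 \<le> i \<Longrightarrow> i \<le> l \<Longrightarrow> occ (T \<eta>) i x \<longleftrightarrow> \<not> occ \<eta> i x"
        using Suc.IH occl by blast
      then show ?thesis
        using Suc.prems t0 True unfolding s s' by auto
    next
      \<comment> \<open>Seat \<open>l\<close> has just been filled, so the induction hypothesis
        covers only the seats below \<open>l\<close>. They are vacant for \<open>T \<eta>\<close>,
        hence a ball of \<open>T \<eta>\<close> in seat \<open>l\<close> would be the lowest one and
        leaves now.\<close>
      case False
      then have all: "\<forall>i\<in>{1..<l}. occ \<eta> i x"
        using Suc.prems True by (auto simp: s)
      then have all': "\<forall>i\<in>{1..<l}. \<not> occ (T \<eta>) i x"
        using Suc.IH by (metis atLeastLessThan_iff order_refl)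
      show ?thesis
        using Suc.prems t0 True all all' False unfolding s s'
        by (cases "j = l") auto
    qed
  next
    case False
    then have occl: "occ \<eta> l x" and l: "l \<ge> 1"
      using Suc.prems by (auto simp: s)
    have "T \<eta> (Suc x) = 1" using occl False l by (auto simp: t)
    moreover have "\<And>i. 1 \<le> i \<Longrightarrow> i \<le> l \<Longrightarrow> occ (T \<eta>) i x \<longleftrightarrow> \<not> occ \<eta> i x"
      using Suc.IH occl by blast
    ultimately show ?thesis
      using Suc.prems False unfolding s s' by auto
  qed
qed simp

text \<open>When \<eta> frees its lowest occupied seat \<open>p\<close>, complementarity up to
  \<open>p\<close> makes \<open>p\<close> the lowest vacant seat of \<open>T \<eta>\<close>.
  Otherwise \<open>T \<eta>\<close> has no ball at the site and neither event occurs.\<close>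

lemma loads_T:
  assumes "\<eta> \<in> Omega" "l \<ge> 1"
  shows "loads (T \<eta>) l x \<longleftrightarrow> unloads \<eta> l x"
proof (cases "T \<eta> (Suc x) = 1")
  case True
  then have n: "\<eta> (Suc x) \<noteq> 1" and "\<exists>l\<ge>1. occ \<eta> l x"
    by (auto simp: T_Suc[OF assms(1)] split: if_splits)
  then obtain p where p: "p \<ge> 1" "occ \<eta> p x" "\<forall>j\<in>{1..<p}. \<not> occ \<eta> j x"
    by (auto elim: ex_least_occ)
  have p': "\<not> occ (T \<eta>) p x" "\<forall>j\<in>{1..<p}. occ (T \<eta>) j x"
    using p occ_T[OF assms(1), of _ p x] by auto
  have "loads (T \<eta>) l x \<longleftrightarrow> l = p"
    unfolding loads_iff[OF T_Omega[OF assms(1)]] using True p' p(1) assms(2)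
    by (metis atLeastLessThan_iff linorder_neqE_nat)
  moreover have "unloads \<eta> l x \<longleftrightarrow> l = p"
    unfolding unloads_iff[OF assms(1)] using n p assms(2)
    by (metis atLeastLessThan_iff linorder_neqE_nat)
  ultimately show ?thesis by simp
next
  case False
  then show ?thesis
    using assms(2) unfolding loads_iff[OF T_Omega[OF assms(1)]] unloads_iff[OF assms(1)]
    by (auto simp: T_Suc[OF assms(1)])
qed

section \<open>The counters \<open>m\<close> and their minimum\<close>

lemma seat_config_Suc:
  assumes "\<eta> \<in> Omega"
  shows "seat_config Up \<eta> l (Suc x) = of_bool (loads \<eta> l x)"
    and "seat_config Down \<eta> l (Suc x) = of_bool (unloads \<eta> l x)"
  by (simp_all del: seat.simps add: seat_of_bool[OF assms] loads_def unloads_def of_bool_def)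

lemma m_0 [simp]: "m \<sigma> \<eta> k 0 = 0"
  by (simp add: m_def)

lemma m_Suc: "m \<sigma> \<eta> k (Suc x) = m \<sigma> \<eta> k x + seat_config \<sigma> \<eta> k (Suc x) - seat_config \<sigma> \<eta> (k + 1) (Suc x)"
  by (simp add: m_def)

text \<open>For each seat, loads minus unloads telescope to its present occupancy.\<close>

lemma m_Up_minus_Down:
  assumes "\<eta> \<in> Omega"
  shows "m Up \<eta> k x - m Down \<eta> k x = of_bool (occ \<eta> k x) - of_bool (occ \<eta> (k + 1) x)"
proof (induction x)
  case (Suc x)
  then show ?case
    by (auto simp: m_Suc seat_config_Suc[OF assms] loads_def unloads_def simp del: seat_config.simps)
qed simp

lemma m_T_Up:
  assumes "\<eta> \<in> Omega" "k \<ge> 1"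
  shows "m Up (T \<eta>) k x = m Down \<eta> k x"
proof (induction x)
  case (Suc x)
  then show ?case using assms(2)
    by (simp add: m_Suc seat_config_Suc[OF assms(1)] seat_config_Suc[OF T_Omega[OF assms(1)]]
        loads_T[OF assms(1)] del: seat_config.simps)
qed simp

text \<open>Both counters reach \<open>j\<close> exactly when their minimum does, so
  \<open>tau\<close> becomes the first passage time of a single function.\<close>

definition m_min :: "(nat \<Rightarrow> int) \<Rightarrow> nat \<Rightarrow> nat \<Rightarrow> int" where
  "m_min \<eta> k x = min (m Up \<eta> k x) (m Down \<eta> k x)"

lemma m_min_0 [simp]: "m_min \<eta> k 0 = 0"
  by (simp add: m_min_def)

lemma m_min_eq_Down:
  assumes "\<eta> \<in> Omega"
  shows "m_min \<eta> k x = m Down \<eta> k x - of_bool (\<not> occ \<eta> k x \<and> occ \<eta> (k + 1) x)"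
  using m_Up_minus_Down[OF assms, of k x]
  by (cases "occ \<eta> k x"; cases "occ \<eta> (k + 1) x") (simp_all add: m_min_def)

text \<open>The two counters differ by at most 1. The minimum grows when seat \<open>k\<close> comes
  to agree with seat \<open>k + 1\<close>, as the smaller counter then catches up. A move of seat
  \<open>k + 1\<close> instead lowers the larger counter to the smaller one.\<close>

lemma m_min_Suc:
  assumes "\<eta> \<in> Omega" "k \<ge> 1"
  shows "m_min \<eta> k (Suc x) = m_min \<eta> k x +
    of_bool (loads \<eta> k x \<and> occ \<eta> (k + 1) x \<or> unloads \<eta> k x \<and> \<not> occ \<eta> (k + 1) x)"
proof -
  have "loads \<eta> (k + 1) x \<Longrightarrow> occ \<eta> k x" "unloads \<eta> (k + 1) x \<Longrightarrow> \<not> occ \<eta> k x"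
    using assms(2) by (simp_all add: loads_iff[OF assms(1)] unloads_iff[OF assms(1)])
  moreover have "loads \<eta> k x \<Longrightarrow> \<not> unloads \<eta> (k + 1) x" "loads \<eta> k x \<Longrightarrow> \<not> loads \<eta> (k + 1) x"
    "unloads \<eta> k x \<Longrightarrow> \<not> loads \<eta> (k + 1) x" "unloads \<eta> k x \<Longrightarrow> \<not> unloads \<eta> (k + 1) x"
    using assms(2) by (auto simp: loads_iff[OF assms(1)] unloads_iff[OF assms(1)])
  ultimately show ?thesis
    unfolding m_min_eq_Down[OF assms(1)] m_Suc seat_config_Suc[OF assms(1)] loads_def unloads_def
    by (cases "occ \<eta> k x"; cases "occ \<eta> k (Suc x)"; cases "occ \<eta> (k + 1) x";
        cases "occ \<eta> (k + 1) (Suc x)") simp_all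
qed

text \<open>Both minima are \<open>m Down \<eta> k x\<close> minus a 0-1 correction. If seat
  \<open>k + 1\<close> of \<eta> is occupied, complementarity makes the corrections equal; if it is
  vacant, the correction for \<eta> vanishes and that for \<open>T \<eta>\<close> is the
  delay.\<close>

lemma m_min_T:
  assumes "\<eta> \<in> Omega" "k \<ge> 1"
  shows "m_min (T \<eta>) k x = m_min \<eta> k x -
    of_bool (occ (T \<eta>) k x \<and> \<not> occ (T \<eta>) (k + 1) x \<and> \<not> occ \<eta> (k + 1) x)"
proof -
  have "m_min (T \<eta>) k x = m Down \<eta> k x - of_bool (occ (T \<eta>) k x \<and> \<not> occ (T \<eta>) (k + 1) x)"
    using m_Up_minus_Down[OF T_Omega[OF assms(1)], of k x] m_T_Up[OF assms, of x]
    by (cases "occ (T \<eta>) k x"; cases "occ (T \<eta>) (k + 1) x") (simp_all add: m_min_def)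
  then show ?thesis
    using occ_T[OF assms(1), of k k x] occ_T[OF assms(1), of k "k + 1" x]
      occ_T[OF assms(1), of "k + 1" "k + 1" x] assms(2)
    by (auto simp: m_min_eq_Down[OF assms(1)])
qed

section \<open>The functions \<open>xi\<close> and their change under \<open>T\<close>\<close>

lemma xi_0 [simp]: "xi \<eta> k 0 = 0"
  by (simp add: xi_def)

lemma xi_Suc:
  assumes "\<eta> \<in> Omega"
  shows "xi \<eta> k (Suc x) = xi \<eta> k x + of_bool (\<forall>l\<in>{1..k}. \<not> loads \<eta> l x \<and> \<not> unloads \<eta> l x)"
proof -
  define F where "F = {l\<in>{1..k}. loads \<eta> l x \<or> unloads \<eta> l x}"
  have fin: "finite F" by (simp add: F_def)
  \<comment> \<open>Two seats cannot move in the same step: the lower one would have to be both full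
    and vacant.\<close>
  have "a = b" if "a \<in> F" "b \<in> F" for a b
    using that unfolding F_def loads_iff[OF assms] unloads_iff[OF assms]
    by (cases a b rule: linorder_cases) auto
  then have "card F \<le> 1"
    using fin by (simp add: card_le_Suc0_iff_eq)
  then have c: "int (card F) = 1 - of_bool (F = {})"
    using card_0_eq[OF fin] by (cases "card F") auto
  have "xi \<eta> k (Suc x) = xi \<eta> k x + 1
      - (\<Sum>l = 1..k. seat_config Up \<eta> l (Suc x) + seat_config Down \<eta> l (Suc x))"
    by (simp add: xi_def sum.distrib del: seat_config.simps)
  also have "(\<Sum>l = 1..k. seat_config Up \<eta> l (Suc x) + seat_config Down \<eta> l (Suc x))
      = (\<Sum>l = 1..k. of_bool (loads \<eta> l x \<or> unloads \<eta> l x))"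
    by (intro sum.cong) (auto simp: seat_config_Suc[OF assms] loads_def unloads_def
        simp del: seat_config.simps)
  also have "\<dots> = int (card F)"
    by (simp add: F_def of_bool_def sum.If_cases Int_def)
  finally show ?thesis unfolding c by (auto simp: F_def)
qed

lemma xi_mono:
  assumes "\<eta> \<in> Omega"
  shows "mono (xi \<eta> k)"
  by (rule monoI, rule lift_Suc_mono_le) (auto simp: xi_Suc[OF assms])

text \<open>With \<open>D\<close> unloads of seat \<open>l\<close> by \<eta>, that seat moves
  \<open>2 D\<close> times plus its occupancy for \<eta>. For \<open>T \<eta>\<close> it is loaded
  \<open>D\<close> times, hence moves \<open>2 D\<close> times minus its occupancy there.\<close>

lemma xi_T:
  assumes "\<eta> \<in> Omega"
  shows "xi (T \<eta>) k x = xi \<eta> k x + (\<Sum>l = 1..k. of_bool (occ \<eta> l x) + of_bool (occ (T \<eta>) l x))"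
proof -
  have up: "(\<Sum>y = 1..x. seat_config Up \<zeta> l y) =
      (\<Sum>y = 1..x. seat_config Down \<zeta> l y) + of_bool (occ \<zeta> l x)" if "\<zeta> \<in> Omega" for \<zeta> l
    by (induction x) (auto simp: seat_config_Suc[OF that] loads_def unloads_def
        simp del: seat_config.simps)
  have tup: "(\<Sum>y = 1..x. seat_config Up (T \<eta>) l y) = (\<Sum>y = 1..x. seat_config Down \<eta> l y)"
    if "l \<ge> 1" for l
    by (induction x) (auto simp: seat_config_Suc[OF assms] seat_config_Suc[OF T_Omega[OF assms]]
        loads_T[OF assms that] simp del: seat_config.simps)
  have "(\<Sum>l = 1..k. \<Sum>y = 1..x. seat_config Up \<eta> l y + seat_config Down \<eta> l y) =
      (\<Sum>l = 1..k. (\<Sum>y = 1..x. seat_config Up (T \<eta>) l y + seat_config Down (T \<eta>) l y)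
        + (of_bool (occ \<eta> l x) + of_bool (occ (T \<eta>) l x)))"
  proof (rule sum.cong)
    fix l assume "l \<in> {1..k}"
    then show "(\<Sum>y = 1..x. seat_config Up \<eta> l y + seat_config Down \<eta> l y) =
        (\<Sum>y = 1..x. seat_config Up (T \<eta>) l y + seat_config Down (T \<eta>) l y)
        + (of_bool (occ \<eta> l x) + of_bool (occ (T \<eta>) l x))"
      using up[OF assms, of l] up[OF T_Omega[OF assms], of l] tup[of l]
      by (simp add: sum.distrib del: seat_config.simps)
  qed simp
  then show ?thesis
    unfolding xi_def by (simp add: sum.distrib del: seat_config.simps)
qed

lemma xi_le_xi_T:
  assumes "\<eta> \<in> Omega"
  shows "xi \<eta> k x \<le> xi (T \<eta>) k x"
  unfolding xi_T[OF assms] by (simp add: sum_nonneg)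

lemma xi_T_at_increment:
  assumes "\<eta> \<in> Omega" "k \<ge> 1" "m_min \<eta> k x < m_min \<eta> k (Suc x)"
  shows "xi (T \<eta>) k (Suc x) = xi \<eta> k (Suc x) + int k"
proof -
  have "loads \<eta> k x \<and> occ \<eta> (k + 1) x \<or> unloads \<eta> k x \<and> \<not> occ \<eta> (k + 1) x"
    using assms(3) unfolding m_min_Suc[OF assms(1,2)] by (auto split: if_splits)
  then have "\<forall>l\<in>{1..k}. occ (T \<eta>) l (Suc x) \<longleftrightarrow> \<not> occ \<eta> l (Suc x)"
  proof
    assume "loads \<eta> k x \<and> occ \<eta> (k + 1) x"
    then have "occ \<eta> k (Suc x)" by (simp add: loads_def)
    then show ?thesis using occ_T[OF assms(1)] by auto
  next
    \<comment> \<open>Seat \<open>k\<close> is vacant afterwards, so \<open>occ_T\<close> is applied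
      before the step instead: there \<open>T \<eta>\<close> fills the seats below \<open>k\<close>
      but not \<open>k\<close>, and the new ball fills \<open>k\<close>.\<close>
    assume a: "unloads \<eta> k x \<and> \<not> occ \<eta> (k + 1) x"
    then have u: "\<eta> (Suc x) \<noteq> 1" "occ \<eta> k x" "\<forall>j\<in>{1..<k}. \<not> occ \<eta> j x"
      by (auto simp: unloads_iff[OF assms(1)])
    have t: "T \<eta> (Suc x) = 1" using u assms(2) by (auto simp: T_Suc[OF assms(1)])
    have "\<forall>j\<in>{1..<k}. occ (T \<eta>) j x" using u occ_T[OF assms(1), of _ k x] by auto
    then have "\<forall>l\<in>{1..k}. occ (T \<eta>) l (Suc x)"
      using t by (auto simp: occ_Suc[OF T_Omega[OF assms(1)]])
    moreover have "\<forall>l\<in>{1..k}. \<not> occ \<eta> l (Suc x)"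
      using u by (auto simp: occ_Suc[OF assms(1)])
    ultimately show ?thesis by blast
  qed
  then have "(\<Sum>l = 1..k. of_bool (occ \<eta> l (Suc x)) + of_bool (occ (T \<eta>) l (Suc x))) = (\<Sum>l = 1..k. 1 :: int)"
    by (intro sum.cong) auto
  then show ?thesis unfolding xi_T[OF assms(1)] by simp
qed

text \<open>Seat \<open>k + 1\<close> is vacant in both carriers, so by \<open>occ_T\<close> \<eta>
  has no occupied seat above \<open>k\<close>. Hence a loading \<open>T \<eta>\<close> finds a
  vacant seat among the first \<open>k\<close>, and otherwise it unloads some seat up to
  \<open>k\<close>.\<close>

lemma xi_T_constant_during_delay:
  assumes "\<eta> \<in> Omega" "k \<ge> 1" "m_min (T \<eta>) k x < m_min \<eta> k x"
  shows "xi (T \<eta>) k (Suc x) = xi (T \<eta>) k x"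
proof -
  note T = T_Omega[OF assms(1)]
  have d: "occ (T \<eta>) k x" "\<not> occ (T \<eta>) (k + 1) x" "\<not> occ \<eta> (k + 1) x"
    using assms(3) unfolding m_min_T[OF assms(1,2)] by (auto split: if_splits)
  have "\<exists>l\<in>{1..k}. loads (T \<eta>) l x \<or> unloads (T \<eta>) l x"
  proof (cases "T \<eta> (Suc x) = 1")
    case True
    then obtain q where q: "q \<ge> 1" "occ \<eta> q x"
      by (auto simp: T_Suc[OF assms(1)] split: if_splits)
    have "q \<le> k"
      using occ_T[OF assms(1), of "k + 1" q x] d q by fastforce
    moreover have "\<not> occ (T \<eta>) q x" using occ_T[OF assms(1), of q q x] q by simp
    then obtain p where "p \<ge> 1" "p \<le> q" "\<not> occ (T \<eta>) p x" "\<forall>j\<in>{1..<p}. occ (T \<eta>) j x"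
      using q(1) by (rule ex_least_vacant)
    ultimately show ?thesis using True by (auto simp: loads_iff[OF T])
  next
    case False
    obtain p where "p \<ge> 1" "p \<le> k" "occ (T \<eta>) p x" "\<forall>j\<in>{1..<p}. \<not> occ (T \<eta>) j x"
      using d(1) assms(2) by (rule ex_least_occ)
    then show ?thesis using False by (auto simp: unloads_iff[OF T])
  qed
  then show ?thesis unfolding xi_Suc[OF T] by auto
qed

lemma xi_T_constant_interval:
  assumes "\<eta> \<in> Omega" "k \<ge> 1" "s \<le> t" "\<And>y. s \<le> y \<Longrightarrow> y < t \<Longrightarrow> m_min (T \<eta>) k y < m_min \<eta> k y"
  shows "xi (T \<eta>) k t = xi (T \<eta>) k s"
  using assms(3,4)
proof (induction t rule: dec_induct)
  case (step n)
  then show ?case using xi_T_constant_during_delay[OF assms(1,2), of n] by simp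
qed simp

section \<open>First passage times and the delay\<close>

lemma m_min_mono:
  assumes "\<eta> \<in> Omega" "k \<ge> 1"
  shows "mono (m_min \<eta> k)"
  by (rule monoI, rule lift_Suc_mono_le) (auto simp: m_min_Suc[OF assms])

lemma tau_eq_enat_iff:
  "tau \<eta> k j = enat t \<longleftrightarrow> m_min \<eta> k t \<ge> int j \<and> (\<forall>y<t. m_min \<eta> k y < int j)"
proof -
  let ?A = "{x. m_min \<eta> k x \<ge> int j}"
  have A: "{x. \<forall>\<sigma>. m \<sigma> \<eta> k x \<ge> int j} = ?A"
    unfolding m_min_def by (auto, (metis arrow.exhaust)+)
  show ?thesis
  proof (cases "?A = {}")
    case True
    then show ?thesis
      unfolding tau_def A by (auto simp: Inf_enat_def)
  next
    case False
    then obtain a where a: "m_min \<eta> k a \<ge> int j" by auto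
    define p where "p = (LEAST x. m_min \<eta> k x \<ge> int j)"
    have p: "m_min \<eta> k p \<ge> int j" "\<forall>y<p. m_min \<eta> k y < int j"
      unfolding p_def using LeastI[of "\<lambda>x. m_min \<eta> k x \<ge> int j", OF a]
      by (auto dest: not_less_Least)
    have "Inf (enat ` ?A) = enat p"
    proof (rule antisym)
      show "Inf (enat ` ?A) \<le> enat p" using p by (intro Inf_lower) auto
      show "enat p \<le> Inf (enat ` ?A)"
        using p(2) by (intro Inf_greatest) (auto simp: not_less[symmetric])
    qed
    then show ?thesis unfolding tau_def A using p
      by (auto simp: not_le) (metis linorder_neqE_nat not_le)+
  qed
qed

lemma tau_eq_enat_if_reached:
  assumes "m_min \<eta> k t \<ge> int j"
  obtains s where "s \<le> t" "tau \<eta> k j = enat s"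
proof -
  let ?P = "\<lambda>x. m_min \<eta> k x \<ge> int j"
  have "(LEAST x. ?P x) \<le> t" using assms by (rule Least_le)
  moreover have "tau \<eta> k j = enat (LEAST x. ?P x)"
    unfolding tau_eq_enat_iff using LeastI[of ?P, OF assms] by (auto dest: not_less_Least)
  ultimately show thesis by (rule that)
qed

lemma xi_T_tau:
  assumes "\<eta> \<in> Omega" "k \<ge> 1" "j \<ge> 1" "tau \<eta> k j = enat s"
  shows "xi (T \<eta>) k s = xi \<eta> k s + int k"
proof -
  have s: "m_min \<eta> k s \<ge> int j" "\<forall>y<s. m_min \<eta> k y < int j"
    using assms(4) by (simp_all add: tau_eq_enat_iff)
  \<comment> \<open>As \<open>j\<close> is positive and \<open>m_min\<close> starts at 0, the
    passage is not at time 0 and is an increment.\<close>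
  with assms(3) obtain r where r: "s = Suc r" by (cases s) auto
  then have "m_min \<eta> k r < m_min \<eta> k (Suc r)" using s by auto
  then show ?thesis using xi_T_at_increment[OF assms(1,2)] r by simp
qed

text \<open>From \<open>s\<close> on, \<eta> has reached \<open>j\<close> while
  \<open>T \<eta>\<close> has not, so the delay persists up to \<open>t\<close>. The bound
  \<open>t\<close> may be arbitrary, which also covers the case that \<open>T \<eta>\<close> never
  reaches \<open>j\<close>.\<close>

lemma xi_T_from_tau:
  assumes "\<eta> \<in> Omega" "k \<ge> 1" "j \<ge> 1" "tau \<eta> k j = enat s" "s \<le> t"
    "\<forall>y<t. m_min (T \<eta>) k y < int j"
  shows "xi (T \<eta>) k t = xi \<eta> k s + int k"
proof -
  have "m_min (T \<eta>) k y < m_min \<eta> k y" if "s \<le> y" "y < t" for y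
    using monoD[OF m_min_mono[OF assms(1,2)] that(1)] assms(4,6) that(2)
    by (fastforce simp: tau_eq_enat_iff)
  then have "xi (T \<eta>) k t = xi (T \<eta>) k s"
    using xi_T_constant_interval[OF assms(1,2,5)] by blast
  then show ?thesis using xi_T_tau[OF assms(1-4)] by simp
qed

lemma tau_T:
  assumes "\<eta> \<in> Omega" "k \<ge> 1" "j \<ge> 1" "tau (T \<eta>) k j = enat t"
  obtains s where "tau \<eta> k j = enat s" "xi (T \<eta>) k t = xi \<eta> k s + int k"
proof -
  have t: "m_min (T \<eta>) k t \<ge> int j" "\<forall>y<t. m_min (T \<eta>) k y < int j"
    using assms(4) by (simp_all add: tau_eq_enat_iff)
  have "m_min \<eta> k t \<ge> int j"
    using t(1) unfolding m_min_T[OF assms(1,2)] by (simp add: of_bool_def split: if_splits)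
  then obtain s where s: "s \<le> t" "tau \<eta> k j = enat s"
    by (rule tau_eq_enat_if_reached)
  then show thesis using that xi_T_from_tau[OF assms(1-3) s(2,1) t(2)] by blast
qed

section \<open>Finite nonempty levels\<close>

lemma xi_passes_level:
  assumes "\<eta> \<in> Omega" "finite (xi_level \<eta> k i)" "xi_level \<eta> k i \<noteq> {}"
  obtains x where "xi \<eta> k x > i"
proof -
  obtain a where a: "xi \<eta> k a = i" using assms(3) by (auto simp: xi_level_def)
  have "\<exists>x\<ge>a. xi \<eta> k x \<noteq> i"
  proof (rule ccontr)
    assume "\<not> ?thesis"
    then have "{a..} \<subseteq> xi_level \<eta> k i" by (auto simp: xi_level_def)
    then show False using assms(2) infinite_Ici finite_subset by blast
  qed
  then obtain x where "x \<ge> a" "xi \<eta> k x \<noteq> i" by blast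
  then have "xi \<eta> k x > i" using monoD[OF xi_mono[OF assms(1)], of a x k] a by simp
  then show thesis by (rule that)
qed

text \<open>Since \<open>xi\<close> starts at 0 and rises by at most 1 per site, it skips no level.
  With \<open>xi_passes_level\<close>, finiteness and nonemptiness reduce to exceeding
  \<open>i\<close> somewhere, a property that \<open>xi_le_xi_T\<close> passes on to
  \<open>T \<eta>\<close>.\<close>

lemma xi_level_finite_nonempty:
  assumes "\<eta> \<in> Omega" "xi \<eta> k x > int i"
  shows "finite (xi_level \<eta> k (int i))" "xi_level \<eta> k (int i) \<noteq> {}"
proof -
  have "y < x" if "xi \<eta> k y = int i" for y
    using monoD[OF xi_mono[OF assms(1)], of x y k] that assms(2) by (cases "y < x") auto
  then show "finite (xi_level \<eta> k (int i))"
    by (auto simp: xi_level_def intro!: finite_subset[OF _ finite_lessThan[of x]])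
  have "\<exists>y. xi \<eta> k y = int i" using assms(2)
  proof (induction x)
    case (Suc x)
    show ?case
    proof (cases "xi \<eta> k x > int i")
      case False
      then have "xi \<eta> k x = int i"
        using Suc.prems by (simp add: xi_Suc[OF assms(1)] of_bool_def split: if_splits)
      then show ?thesis ..
    qed (rule Suc.IH)
  qed simp
  then show "xi_level \<eta> k (int i) \<noteq> {}" by (auto simp: xi_level_def)
qed

lemma ecard_pos_iff: "0 < ecard A \<longleftrightarrow> A \<noteq> {}"
  by (auto simp: ecard_def zero_enat_def card_gt_0_iff)

lemma ecard_less_infinity_iff: "ecard A < \<infinity> \<longleftrightarrow> finite A"
  by (auto simp: ecard_def)

theorem theorem2p1:
  fixes \<eta> :: "nat \<Rightarrow> int" and k i :: nat
  assumes "\<eta> \<in> Omega" and "k \<ge> 1"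
    and "0 < ecard (xi_level \<eta> k (int i))" and "ecard (xi_level \<eta> k (int i)) < \<infinity>"
  shows "0 < ecard (xi_level (T \<eta>) k (int i)) \<and> ecard (xi_level (T \<eta>) k (int i)) < \<infinity>
    \<and> zeta (T \<eta>) k (int i) = zeta \<eta> k (int i - int k)"
proof -
  obtain x where "xi \<eta> k x > int i"
    using xi_passes_level[OF assms(1)] assms(3,4)
    unfolding ecard_pos_iff ecard_less_infinity_iff by blast
  then have x: "xi (T \<eta>) k x > int i" using xi_le_xi_T[OF assms(1), of k x] by simp
  have "tau (T \<eta>) k j \<in> enat ` xi_level (T \<eta>) k (int i)
      \<longleftrightarrow> tau \<eta> k j \<in> enat ` xi_level \<eta> k (int i - int k)" if j: "j \<ge> 1" for j
  proof
    assume "tau (T \<eta>) k j \<in> enat ` xi_level (T \<eta>) k (int i)"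
    then obtain t where "tau (T \<eta>) k j = enat t" "xi (T \<eta>) k t = int i"
      by (auto simp: xi_level_def)
    then show "tau \<eta> k j \<in> enat ` xi_level \<eta> k (int i - int k)"
      using tau_T[OF assms(1,2) j, of t] by (force simp: xi_level_def)
  next
    assume "tau \<eta> k j \<in> enat ` xi_level \<eta> k (int i - int k)"
    then obtain s where s: "tau \<eta> k j = enat s" "xi \<eta> k s + int k = int i"
      by (auto simp: xi_level_def)
    \<comment> \<open>An endless delay would freeze \<open>xi (T \<eta>) k\<close> at
      \<open>i\<close> from \<open>s\<close> on, although it exceeds \<open>i\<close> at
      \<open>x\<close>.\<close>
    have "\<exists>t. m_min (T \<eta>) k t \<ge> int j"
    proof (rule ccontr)
      assume "\<not> ?thesis"
      then have "xi (T \<eta>) k (max s x) = int i"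
        using xi_T_from_tau[OF assms(1,2) j s(1), of "max s x"] s(2) by (simp add: not_le)
      then show False
        using x monoD[OF xi_mono[OF T_Omega[OF assms(1)]] max.cobounded2, of k x s] by simp
    qed
    then obtain t where t: "tau (T \<eta>) k j = enat t" using tau_eq_enat_if_reached by metis
    then obtain s' where "tau \<eta> k j = enat s'" "xi (T \<eta>) k t = xi \<eta> k s' + int k"
      by (rule tau_T[OF assms(1,2) j])
    with s t show "tau (T \<eta>) k j \<in> enat ` xi_level (T \<eta>) k (int i)"
      by (auto simp: xi_level_def)
  qed
  then have sets: "{j. j \<ge> 1 \<and> tau (T \<eta>) k j \<in> enat ` xi_level (T \<eta>) k (int i)}
      = {j. j \<ge> 1 \<and> tau \<eta> k j \<in> enat ` xi_level \<eta> k (int i - int k)}"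
    by auto
  \<comment> \<open>For a negative index the level is empty, so the counted set agrees with the
    convention in \<open>zeta\<close>.\<close>
  have "0 \<le> xi \<eta> k y" for y
    using monoD[OF xi_mono[OF assms(1)], of 0 y k] by simp
  then have "xi_level \<eta> k (int i - int k) = {}" if "int i - int k < 0"
    using that unfolding xi_level_def by (metis (mono_tags, lifting) Collect_empty_eq not_le)
  then have "zeta (T \<eta>) k (int i) = zeta \<eta> k (int i - int k)"
    unfolding zeta_def sets by (auto simp: ecard_def zero_enat_def)
  then show ?thesis
    using xi_level_finite_nonempty[OF T_Omega[OF assms(1)] x]
    by (simp only: ecard_pos_iff ecard_less_infinity_iff simp_thms)
qed

end
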